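(* Consider the nominal system $\dot p_{\mathrm n}=v_{\mathrm n}$, $\dot v_{\mathrm n}=u_{\mathrm n}$ and the attacked system $\dot p=v$, $\dot v=u$ in $\mathbb{R}^2$, with equal initial conditions $p(0)=p_{\mathrm n}(0)$, $v(0)=v_{\mathrm n}(0)$, and let $u^{\mathrm{GNSS}}:\mathbb{R}_{\ge 0}\to\mathbb{R}^2$ be the GNSS spoofing signal. The attack $(u,u^{\mathrm{GNSS}})$ is undetectable if and only if it satisfies $$u=a_{\mathrm r}\,p+w\quad\text{and}\quad u^{\mathrm{GNSS}}=p_{\mathrm n}-p,$$ whenever $\|p\|\neq 0$ (a pointwise-in-time qualifier: $p$ is allowed to vanish at some times), where $w$ is an $\mathbb{R}^2$-valued function with $w^{\mathsf T}p=0$ and $$a_{\mathrm r}=\frac{u_{\mathrm n}^{\mathsf T}p_{\mathrm n}+\|v_{\mathrm n}\|^2-\|v\|^2}{\|p\|^2}.$$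
   Context: Nominal robot: position $p_{\mathrm n}:\mathbb{R}_{\ge0}\to\mathbb{R}^2$, velocity $v_{\mathrm n}:\mathbb{R}_{\ge0}\to\mathbb{R}^2$, nominal control $u_{\mathrm n}:\mathbb{R}_{\ge0}\to\mathbb{R}^2$ piecewise continuous with $\|u_{\mathrm n}\|\le u_{\max}$, where $u_{\max}>0$; dynamics $\dot p_{\mathrm n}=v_{\mathrm n}$, $\dot v_{\mathrm n}=u_{\mathrm n}$. Nominal measurements: $y^{\mathrm{GNSS}}_{\mathrm n}=p_{\mathrm n}$ and $y^{\mathrm{RSSI}}_{\mathrm n}=p_{\mathrm n}^{\mathsf T}p_{\mathrm n}$. Attacked robot: position $p$, velocity $v$, attacked control $u$ with values in $\mathbb{R}^2$ (piecewise continuous, $\|u\|\le u_{\max}$), dynamics $\dot p=v$, $\dot v=u$. Measurements under attack: $y^{\mathrm{GNSS}}=p+u^{\mathrm{GNSS}}$ and $y^{\mathrm{RSSI}}=p^{\mathsf T}p$. It is assumed that $p(0)=p_{\mathrm n}(0)$ and $v(0)=v_{\mathrm n}(0)$. Undetectable attack: $(u,u^{\mathrm{GNSS}})$ is undetectable if $y^{\mathrm{GNSS}}=y^{\mathrm{GNSS}}_{\mathrm n}$ and $y^{\mathrm{RSSI}}=y^{\mathrm{RSSI}}_{\mathrm n}$ at all times; it is detectable otherwise. At times when $\|p\|=0$, the attack input $u$ is regarded as unconstrained.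
   Formalization: The "if" direction assumes p vanishes identically on no time interval (it fails for p≡0 with p_n moving); u^GNSS = p_n − p is required at all times, also where p = 0; the law for u is stated at times where u and u_n are continuous. *)

theory Defs
  imports "HOL-Analysis.Analysis"
begin

text \<open>
  Signals on the time axis \<open>t \<ge> 0\<close> are functions on \<open>real\<close>; their values at negative times are
  never used. Accordingly, continuity and derivatives are taken within \<open>{0..}\<close> (one-sided at 0).
\<close>

definition continuity_time :: "(real \<Rightarrow> 'a::topological_space) \<Rightarrow> real \<Rightarrow> bool" where
  "continuity_time f t \<longleftrightarrow> continuous (at t within {0..}) f"

text \<open>The value of a piecewise continuous signal at one of its jumps is arbitrary.\<close>

definition piecewise_continuous :: "(real \<Rightarrow> 'a::topological_space) \<Rightarrow> bool" where
  "piecewise_continuous f \<longleftrightarrow>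
     (\<forall>T\<ge>0. finite {t \<in> {0..T}. \<not> continuity_time f t}) \<and>
     (\<forall>t\<ge>0. \<exists>l. (f \<longlongrightarrow> l) (at_right t)) \<and>
     (\<forall>t>0. \<exists>l. (f \<longlongrightarrow> l) (at_left t))"

definition admissible_control :: "real \<Rightarrow> (real \<Rightarrow> real^2) \<Rightarrow> bool" where
  "admissible_control u_max u \<longleftrightarrow> piecewise_continuous u \<and> (\<forall>t\<ge>0. norm (u t) \<le> u_max)"

text \<open>
  Since \<open>u\<close> may jump, \<open>v\<close> is a solution of \<open>v' = u\<close> in the usual sense for piecewise continuous
  inputs: it is continuous, and the equation holds at every time at which \<open>u\<close> is continuous.
\<close>

definition robot_trajectory ::
    "(real \<Rightarrow> real^2) \<Rightarrow> (real \<Rightarrow> real^2) \<Rightarrow> (real \<Rightarrow> real^2) \<Rightarrow> bool" where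
  "robot_trajectory p v u \<longleftrightarrow>
     (\<forall>t\<ge>0. (p has_vector_derivative v t) (at t within {0..})) \<and>
     continuous_on {0..} v \<and>
     (\<forall>t\<ge>0. continuity_time u t \<longrightarrow> (v has_vector_derivative u t) (at t within {0..}))"

definition y_GNSS :: "(real \<Rightarrow> real^2) \<Rightarrow> (real \<Rightarrow> real^2) \<Rightarrow> real \<Rightarrow> real^2" where
  "y_GNSS p u_GNSS t = p t + u_GNSS t"

definition y_GNSS_nominal :: "(real \<Rightarrow> real^2) \<Rightarrow> real \<Rightarrow> real^2" where
  "y_GNSS_nominal p\<^sub>n t = p\<^sub>n t"

definition y_RSSI :: "(real \<Rightarrow> real^2) \<Rightarrow> real \<Rightarrow> real" where
  "y_RSSI p t = p t \<bullet> p t"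

text \<open>The attack control \<open>u\<close> enters through the attacked position \<open>p\<close> that it generates.\<close>

definition undetectable ::
    "(real \<Rightarrow> real^2) \<Rightarrow> (real \<Rightarrow> real^2) \<Rightarrow> (real \<Rightarrow> real^2) \<Rightarrow> bool" where
  "undetectable p\<^sub>n p u_GNSS \<longleftrightarrow>
     (\<forall>t\<ge>0. y_GNSS p u_GNSS t = y_GNSS_nominal p\<^sub>n t \<and> y_RSSI p t = y_RSSI p\<^sub>n t)"

definition radial_gain ::
    "(real \<Rightarrow> real^2) \<Rightarrow> (real \<Rightarrow> real^2) \<Rightarrow> (real \<Rightarrow> real^2) \<Rightarrow>
     (real \<Rightarrow> real^2) \<Rightarrow> (real \<Rightarrow> real^2) \<Rightarrow> real \<Rightarrow> real" where
  "radial_gain p\<^sub>n v\<^sub>n u\<^sub>n p v t =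
     (u\<^sub>n t \<bullet> p\<^sub>n t + (norm (v\<^sub>n t))\<^sup>2 - (norm (v t))\<^sup>2) / (norm (p t))\<^sup>2"

text \<open>
  The control law for \<open>u\<close> is required at the times with \<open>p t \<noteq> 0\<close>, apart from the jumps of \<open>u\<close> and
  \<open>u\<^sub>n\<close>, where the values of the controls carry no information. The qualifier \<open>p t \<noteq> 0\<close> frees only
  the control \<open>u\<close>, not the spoofing signal, which would otherwise be arbitrary when \<open>p t = 0\<close>.
\<close>

definition attack_law ::
    "(real \<Rightarrow> real^2) \<Rightarrow> (real \<Rightarrow> real^2) \<Rightarrow> (real \<Rightarrow> real^2) \<Rightarrow>
     (real \<Rightarrow> real^2) \<Rightarrow> (real \<Rightarrow> real^2) \<Rightarrow> (real \<Rightarrow> real^2) \<Rightarrow> (real \<Rightarrow> real^2) \<Rightarrow> bool" where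
  "attack_law p\<^sub>n v\<^sub>n u\<^sub>n p v u u_GNSS \<longleftrightarrow>
     (\<exists>w :: real \<Rightarrow> real^2.
        (\<forall>t\<ge>0. w t \<bullet> p t = 0) \<and>
        (\<forall>t\<ge>0. continuity_time u t \<and> continuity_time u\<^sub>n t \<and> norm (p t) \<noteq> 0 \<longrightarrow>
           u t = radial_gain p\<^sub>n v\<^sub>n u\<^sub>n p v t *\<^sub>R p t + w t)) \<and>
     (\<forall>t\<ge>0. u_GNSS t = p\<^sub>n t - p t)"

text \<open>
  Individual zeros of \<open>p\<close> are harmless, even infinitely many, but while \<open>p\<close> rests at the origin
  the control law says nothing and \<open>p\<^sub>n\<close> can move away from the origin, changing the RSSI signal.
\<close>

definition vanishes_on_no_interval :: "(real \<Rightarrow> real^2) \<Rightarrow> bool" where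
  "vanishes_on_no_interval p \<longleftrightarrow> (\<forall>a b. 0 \<le> a \<and> a < b \<longrightarrow> (\<exists>t\<in>{a<..<b}. p t \<noteq> 0))"

end

theory Submission
  imports Defs
begin

text \<open>
  Once the spoofing signal is \<open>p\<^sub>n - p\<close>, undetectability says that \<open>p \<bullet> p\<close> and \<open>p\<^sub>n \<bullet> p\<^sub>n\<close> agree
  at all times. Differentiating \<open>p \<bullet> p\<close> twice gives \<open>2 (p \<bullet> u + v \<bullet> v)\<close>, and the first two
  Taylor coefficients at time 0 agree by the initial conditions, so equality of the squared ranges
  is equivalent to the \<^emph>\<open>range balance\<close>
  \<open>p \<bullet> u + v \<bullet> v = p\<^sub>n \<bullet> u\<^sub>n + v\<^sub>n \<bullet> v\<^sub>n\<close> at all times at which both controls are continuous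
  (\<open>equal_ranges_iff_range_balance\<close>). The jumps are locally finite, hence invisible to the
  continuous function \<open>p \<bullet> v - p\<^sub>n \<bullet> v\<^sub>n\<close>. Where \<open>p\<close> is nonzero, the balance prescribes exactly the
  component of \<open>u\<close> along \<open>p\<close>, and this is the control law (\<open>radial_component_iff\<close>).

  The law is silent at the zeros of \<open>p\<close>, which may form a Cantor set of positive measure, so they
  cannot be discarded as exceptional points in the integration. Instead the balance extends to them
  by continuity: when \<open>p\<close> vanishes on no interval, every time is a limit of times at which \<open>p\<close> is
  nonzero and both controls are continuous (\<open>regular_times_accumulate\<close>).
\<close>

section \<open>Derivatives of signals on the time axis\<close>

lemma derivative_on_time_axis_unique:
  fixes f :: "real \<Rightarrow> 'a::real_normed_vector"
  assumes "(f has_vector_derivative f') (at t within {0..})"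
    and "(f has_vector_derivative f'') (at t within {0..})" and "t \<ge> 0"
  shows "f' = f''"
proof (rule vector_derivative_unique_within)
  show "at t within {t<..} \<noteq> bot"
    by (rule trivial_limit_at_right_real)
  show "(f has_vector_derivative f') (at t within {t<..})"
    "(f has_vector_derivative f'') (at t within {t<..})"
    using assms by (auto intro: has_vector_derivative_within_subset)
qed

lemma vanishing_signal_derivative_zero:
  fixes f :: "real \<Rightarrow> 'a::real_normed_vector"
  assumes deriv: "(f has_vector_derivative f') (at t within {0..})" and "t \<ge> 0"
    and zero: "\<And>s. s \<ge> 0 \<Longrightarrow> f s = 0"
  shows "f' = 0"
proof (rule derivative_on_time_axis_unique[OF deriv _ \<open>t \<ge> 0\<close>])
  show "(f has_vector_derivative 0) (at t within {0..})"
    by (rule has_vector_derivative_transform[where f = "\<lambda>_. 0"]) (use assms in auto)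
qed

lemma constant_if_derivative_zero_off_locally_finite:
  fixes f :: "real \<Rightarrow> 'a::banach"
  assumes cont: "continuous_on {0..} f"
    and fin: "\<And>T. T \<ge> 0 \<Longrightarrow> finite (J \<inter> {0..T})"
    and deriv: "\<And>t. t \<ge> 0 \<Longrightarrow> t \<notin> J \<Longrightarrow> (f has_vector_derivative 0) (at t within {0..})"
    and "t \<ge> 0"
  shows "f t = f 0"
proof (rule has_derivative_zero_unique_strong_interval[where a = 0 and b = t and k = "J \<inter> {0..t}"])
  show "finite (J \<inter> {0..t})" using fin \<open>t \<ge> 0\<close> .
  show "continuous_on {0..t} f" using cont by (rule continuous_on_subset) auto
  show "(f has_derivative (\<lambda>h. 0)) (at x within {0..t})" if "x \<in> {0..t} - J \<inter> {0..t}" for x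
    using has_vector_derivative_within_subset[OF deriv, of x "{0..t}"] that
    by (auto simp: has_vector_derivative_def)
qed (use \<open>t \<ge> 0\<close> in auto)

section \<open>Range balance\<close>

lemma robot_trajectoryD:
  assumes "robot_trajectory p v u"
  shows "t \<ge> 0 \<Longrightarrow> (p has_vector_derivative v t) (at t within {0..})"
    and "continuous_on {0..} p" and "continuous_on {0..} v"
    and "t \<ge> 0 \<Longrightarrow> continuity_time u t \<Longrightarrow> (v has_vector_derivative u t) (at t within {0..})"
  using assms unfolding robot_trajectory_def
  by (auto intro!: has_vector_derivative_continuous simp: continuous_on_eq_continuous_within)

lemma squared_range_derivative:
  assumes "robot_trajectory p v u" and "t \<ge> 0"
  shows "((\<lambda>s. p s \<bullet> p s) has_vector_derivative 2 * (p t \<bullet> v t)) (at t within {0..})"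
proof -
  note p = robot_trajectoryD(1)[OF assms]
  show ?thesis
    using bounded_bilinear.has_vector_derivative[OF bounded_bilinear_inner p p]
    by (simp add: inner_commute)
qed

lemma radial_momentum_derivative:
  assumes "robot_trajectory p v u" and "t \<ge> 0" and "continuity_time u t"
  shows "((\<lambda>s. p s \<bullet> v s) has_vector_derivative p t \<bullet> u t + v t \<bullet> v t) (at t within {0..})"
  using bounded_bilinear.has_vector_derivative[OF bounded_bilinear_inner
      robot_trajectoryD(1)[OF assms(1,2)] robot_trajectoryD(4)[OF assms]] .

lemma jumps_locally_finite:
  assumes "piecewise_continuous u" and "piecewise_continuous u'" and "T \<ge> 0"
  shows "finite ({t. \<not> (continuity_time u t \<and> continuity_time u' t)} \<inter> {0..T})"
proof (rule finite_subset)
  show "{t. \<not> (continuity_time u t \<and> continuity_time u' t)} \<inter> {0..T} \<subseteq>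
    {t \<in> {0..T}. \<not> continuity_time u t} \<union> {t \<in> {0..T}. \<not> continuity_time u' t}" by auto
qed (use assms in \<open>auto simp: piecewise_continuous_def\<close>)

definition range_balance ::
    "(real \<Rightarrow> real^2) \<Rightarrow> (real \<Rightarrow> real^2) \<Rightarrow> (real \<Rightarrow> real^2) \<Rightarrow>
     (real \<Rightarrow> real^2) \<Rightarrow> (real \<Rightarrow> real^2) \<Rightarrow> (real \<Rightarrow> real^2) \<Rightarrow> real \<Rightarrow> bool" where
  "range_balance p v u p' v' u' t \<longleftrightarrow>
     p t \<bullet> u t + v t \<bullet> v t = p' t \<bullet> u' t + v' t \<bullet> v' t"

text \<open>
  The difference of the squared ranges starts at 0 with slope 0, so it vanishes identically exactly
  when its second derivative does. That second derivative need not exist at the jumps of the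
  controls; there the continuity of the velocities carries the first derivative across.
\<close>

lemma equal_ranges_iff_range_balance:
  assumes traj: "robot_trajectory p v u" and traj': "robot_trajectory p' v' u'"
    and pc: "piecewise_continuous u" and pc': "piecewise_continuous u'"
    and init: "p 0 = p' 0" "v 0 = v' 0"
  shows "(\<forall>t\<ge>0. p t \<bullet> p t = p' t \<bullet> p' t) \<longleftrightarrow>
    (\<forall>t\<ge>0. continuity_time u t \<and> continuity_time u' t \<longrightarrow> range_balance p v u p' v' u' t)"
proof -
  define g where "g = (\<lambda>t. p t \<bullet> p t - p' t \<bullet> p' t)"
  define h where "h = (\<lambda>t. p t \<bullet> v t - p' t \<bullet> v' t)"
  define k where "k = (\<lambda>t. (p t \<bullet> u t + v t \<bullet> v t) - (p' t \<bullet> u' t + v' t \<bullet> v' t))"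
  have dg: "(g has_vector_derivative 2 * h t) (at t within {0..})" if "t \<ge> 0" for t
    using has_vector_derivative_diff[OF squared_range_derivative[OF traj that]
        squared_range_derivative[OF traj' that]]
    by (simp add: g_def h_def algebra_simps)
  have dh: "(h has_vector_derivative k t) (at t within {0..})"
    if "t \<ge> 0" "continuity_time u t" "continuity_time u' t" for t
    unfolding h_def k_def
    by (intro has_vector_derivative_diff radial_momentum_derivative traj traj' that)
  have cont_h: "continuous_on {0..} h"
    unfolding h_def by (intro continuous_intros robot_trajectoryD[OF traj] robot_trajectoryD[OF traj'])
  have cont_g: "continuous_on {0..} g"
    unfolding g_def by (intro continuous_intros robot_trajectoryD[OF traj] robot_trajectoryD[OF traj'])
  have "(\<forall>t\<ge>0. g t = 0) \<longleftrightarrow>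
    (\<forall>t\<ge>0. continuity_time u t \<and> continuity_time u' t \<longrightarrow> k t = 0)"
  proof (intro iffI allI impI; (elim conjE)?)
    fix t :: real
    assume g0: "\<forall>t\<ge>0. g t = 0" and t: "t \<ge> 0" "continuity_time u t" "continuity_time u' t"
    have "h s = 0" if "s \<ge> 0" for s
      using vanishing_signal_derivative_zero[OF dg[OF that] that] g0 by simp
    then show "k t = 0"
      using vanishing_signal_derivative_zero[OF dh[OF t] t(1)] by blast
  next
    fix t :: real
    assume k0: "\<forall>t\<ge>0. continuity_time u t \<and> continuity_time u' t \<longrightarrow> k t = 0" and "t \<ge> 0"
    have "h s = h 0" if "s \<ge> 0" for s
      by (rule constant_if_derivative_zero_off_locally_finite[OF cont_h
            jumps_locally_finite[OF pc pc'] _ that])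
        (use dh k0 in fastforce)+
    then have "h s = 0" if "s \<ge> 0" for s
      using that init by (simp add: h_def)
    then have "g t = g 0"
      by (intro constant_if_derivative_zero_off_locally_finite[OF cont_g, where J = "{}"])
        (use dg \<open>t \<ge> 0\<close> in fastforce)+
    then show "g t = 0" using init by (simp add: g_def)
  qed
  then show ?thesis by (simp add: g_def k_def range_balance_def)
qed

section \<open>Passing to the zeros of the attacked position\<close>

text \<open>
  The set where \<open>p\<close> is nonzero is open, so once it meets an interval it contains a smaller one,
  which finitely many jumps cannot fill.
\<close>

lemma regular_times_accumulate:
  fixes p :: "real \<Rightarrow> real^2"
  assumes cont: "continuous_on {0..} p" and van: "vanishes_on_no_interval p"
    and fin: "\<And>T. T \<ge> 0 \<Longrightarrow> finite (J \<inter> {0..T})" and "t \<ge> 0"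
  shows "t islimpt {s. s \<ge> 0 \<and> p s \<noteq> 0 \<and> s \<notin> J}"
  unfolding islimpt_approachable_real
proof (intro allI impI)
  fix e :: real assume "e > 0"
  define U where "U = {s \<in> {t<..<t + e}. p s \<noteq> 0}"
  have "continuous_on {t<..<t + e} p"
    using cont \<open>t \<ge> 0\<close> by (auto intro: continuous_on_subset)
  then have "open U"
    unfolding U_def using continuous_open_preimage[of "{t<..<t + e}" p "- {0}"]
    by (simp add: vimage_def Int_def open_Compl)
  moreover have "U \<noteq> {}"
    using van[unfolded vanishes_on_no_interval_def, rule_format, of t "t + e"] \<open>t \<ge> 0\<close> \<open>e > 0\<close>
    by (auto simp: U_def)
  ultimately have "infinite U"
    using finite_imp_not_open by blast
  then have "\<not> U \<subseteq> J \<inter> {0..t + e}"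
    using fin[of "t + e"] \<open>t \<ge> 0\<close> \<open>e > 0\<close> finite_subset[of U "J \<inter> {0..t + e}"] by linarith
  then obtain s where "s \<in> U" "s \<notin> J"
    using \<open>t \<ge> 0\<close> by (fastforce simp: U_def)
  then show "\<exists>s\<in>{s. s \<ge> 0 \<and> p s \<noteq> 0 \<and> s \<notin> J}. s \<noteq> t \<and> \<bar>s - t\<bar> < e"
    using \<open>t \<ge> 0\<close> by (intro bexI[of _ s]) (auto simp: U_def)
qed

text \<open>
  At a time at which both controls are continuous, so are both sides of the balance, and an
  equation between them passes to the limit.
\<close>

lemma range_balance_extends:
  assumes traj: "robot_trajectory p v u" and traj': "robot_trajectory p' v' u'"
    and cu: "continuity_time u t" and cu': "continuity_time u' t" and "t \<ge> 0"
    and lim: "t islimpt S" and "S \<subseteq> {0..}"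
    and bal: "\<And>s. s \<in> S \<Longrightarrow> range_balance p v u p' v' u' s"
  shows "range_balance p v u p' v' u' t"
proof -
  define k where "k = (\<lambda>t. (p t \<bullet> u t + v t \<bullet> v t) - (p' t \<bullet> u' t + v' t \<bullet> v' t))"
  have "continuous (at t within {0..}) f" if "continuous_on {0..} f" for f :: "real \<Rightarrow> real^2"
    using that \<open>t \<ge> 0\<close> by (simp add: continuous_on_eq_continuous_within)
  then have "continuous (at t within {0..}) k"
    unfolding k_def using cu cu' unfolding continuity_time_def
    by (intro continuous_intros) (auto intro: robot_trajectoryD[OF traj] robot_trajectoryD[OF traj'])
  then have "continuous (at t within S) k"
    using \<open>S \<subseteq> {0..}\<close> by (rule continuous_within_subset)
  then have "(k \<longlongrightarrow> k t) (at t within S)"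
    by (simp add: continuous_within)
  moreover have "(k \<longlongrightarrow> 0) (at t within S)"
    by (rule tendsto_eventually)
      (use bal in \<open>auto simp: k_def range_balance_def eventually_at_filter\<close>)
  ultimately have "k t = 0"
    using lim tendsto_unique trivial_limit_within by blast
  then show ?thesis by (simp add: k_def range_balance_def)
qed

section \<open>Control law and undetectability\<close>

lemma radial_component_iff:
  fixes p u :: "'a::real_inner"
  assumes "p \<noteq> 0"
  shows "p \<bullet> u = c \<longleftrightarrow> (\<exists>w. w \<bullet> p = 0 \<and> u = (c / (norm p)\<^sup>2) *\<^sub>R p + w)"
proof
  assume "p \<bullet> u = c"
  then have "(u - (c / (norm p)\<^sup>2) *\<^sub>R p) \<bullet> p = 0"
    using assms
    by (simp add: inner_diff_left inner_diff_right inner_commute power2_norm_eq_inner)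
  then show "\<exists>w. w \<bullet> p = 0 \<and> u = (c / (norm p)\<^sup>2) *\<^sub>R p + w"
    by (intro exI[of _ "u - (c / (norm p)\<^sup>2) *\<^sub>R p"]) simp
next
  assume "\<exists>w. w \<bullet> p = 0 \<and> u = (c / (norm p)\<^sup>2) *\<^sub>R p + w"
  then show "p \<bullet> u = c"
    using assms by (auto simp: inner_add_right inner_commute power2_norm_eq_inner)
qed

lemma attack_law_iff_range_balance:
  "attack_law p\<^sub>n v\<^sub>n u\<^sub>n p v u u_GNSS \<longleftrightarrow>
     (\<forall>t\<ge>0. continuity_time u t \<and> continuity_time u\<^sub>n t \<and> p t \<noteq> 0 \<longrightarrow>
        range_balance p v u p\<^sub>n v\<^sub>n u\<^sub>n t) \<and>
     (\<forall>t\<ge>0. u_GNSS t = p\<^sub>n t - p t)"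
proof -
  define R where "R t \<longleftrightarrow> continuity_time u t \<and> continuity_time u\<^sub>n t \<and> p t \<noteq> 0" for t
  define L where "L t w \<longleftrightarrow> w \<bullet> p t = 0 \<and>
    (R t \<longrightarrow> u t = radial_gain p\<^sub>n v\<^sub>n u\<^sub>n p v t *\<^sub>R p t + w)" for t w
  have ex_iff: "(\<exists>w. L t w) \<longleftrightarrow> (R t \<longrightarrow> range_balance p v u p\<^sub>n v\<^sub>n u\<^sub>n t)" for t
  proof (cases "R t")
    case True
    then have "p t \<noteq> 0" by (simp add: R_def)
    have "(\<exists>w. L t w) \<longleftrightarrow> p t \<bullet> u t = u\<^sub>n t \<bullet> p\<^sub>n t + (norm (v\<^sub>n t))\<^sup>2 - (norm (v t))\<^sup>2"
      unfolding radial_component_iff[OF \<open>p t \<noteq> 0\<close>] L_def radial_gain_def using True by simp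
    with True show ?thesis
      by (auto simp: range_balance_def power2_norm_eq_inner inner_commute)
  next
    case False
    \<comment> \<open>At jumps and at zeros of \<open>p\<close> the only demand on \<open>w\<close> is orthogonality to \<open>p t\<close>.\<close>
    then have "L t 0" by (simp add: L_def)
    with False show ?thesis by blast
  qed
  have "(\<exists>w. (\<forall>t\<ge>0. w t \<bullet> p t = 0) \<and> (\<forall>t\<ge>0. R t \<longrightarrow>
           u t = radial_gain p\<^sub>n v\<^sub>n u\<^sub>n p v t *\<^sub>R p t + w t)) \<longleftrightarrow> (\<exists>w. \<forall>t\<ge>0. L t (w t))"
    by (simp add: L_def) blast
  also have "\<dots> \<longleftrightarrow> (\<forall>t\<ge>0. \<exists>w. L t w)" by metis
  finally show ?thesis
    unfolding attack_law_def ex_iff by (simp add: R_def)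
qed

lemma undetectable_iff:
  "undetectable p\<^sub>n p u_GNSS \<longleftrightarrow>
     (\<forall>t\<ge>0. p t \<bullet> p t = p\<^sub>n t \<bullet> p\<^sub>n t) \<and> (\<forall>t\<ge>0. u_GNSS t = p\<^sub>n t - p t)"
  unfolding undetectable_def y_GNSS_def y_GNSS_nominal_def y_RSSI_def
  by (auto simp: algebra_simps)

theorem corollary8:
  fixes p\<^sub>n v\<^sub>n u\<^sub>n p v u u_GNSS :: "real \<Rightarrow> real^2" and u_max :: real
  assumes "u_max > 0"
    and "admissible_control u_max u\<^sub>n" and "robot_trajectory p\<^sub>n v\<^sub>n u\<^sub>n"
    and "admissible_control u_max u" and "robot_trajectory p v u"
    and "p 0 = p\<^sub>n 0" and "v 0 = v\<^sub>n 0"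
  shows "(undetectable p\<^sub>n p u_GNSS \<longrightarrow> attack_law p\<^sub>n v\<^sub>n u\<^sub>n p v u u_GNSS) \<and>
         (vanishes_on_no_interval p \<longrightarrow>
            (undetectable p\<^sub>n p u_GNSS \<longleftrightarrow> attack_law p\<^sub>n v\<^sub>n u\<^sub>n p v u u_GNSS))"
proof -
  have pc: "piecewise_continuous u" "piecewise_continuous u\<^sub>n"
    using assms by (auto simp: admissible_control_def)
  note undet = undetectable_iff[of p\<^sub>n p u_GNSS,
      unfolded equal_ranges_iff_range_balance[OF assms(5,3) pc assms(6,7)]]
  have necessary: "attack_law p\<^sub>n v\<^sub>n u\<^sub>n p v u u_GNSS" if "undetectable p\<^sub>n p u_GNSS"
    using that unfolding undet attack_law_iff_range_balance by blast
  have sufficient: "undetectable p\<^sub>n p u_GNSS"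
    if van: "vanishes_on_no_interval p" and law: "attack_law p\<^sub>n v\<^sub>n u\<^sub>n p v u u_GNSS"
  proof -
    define S where
      "S = {s. s \<ge> 0 \<and> p s \<noteq> 0 \<and> s \<notin> {t. \<not> (continuity_time u t \<and> continuity_time u\<^sub>n t)}}"
    have balS: "range_balance p v u p\<^sub>n v\<^sub>n u\<^sub>n s" if "s \<in> S" for s
      using law that unfolding attack_law_iff_range_balance S_def by blast
    have "range_balance p v u p\<^sub>n v\<^sub>n u\<^sub>n t"
      if t: "t \<ge> 0" "continuity_time u t" "continuity_time u\<^sub>n t" for t
    proof (rule range_balance_extends[OF assms(5,3) t(2,3,1) _ _ balS])
      show "t islimpt S"
        unfolding S_def using robot_trajectoryD(2)[OF assms(5)] van jumps_locally_finite[OF pc] t(1)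
        by (rule regular_times_accumulate)
    qed (auto simp: S_def)
    with law show ?thesis
      unfolding undet attack_law_iff_range_balance by blast
  qed
  from necessary sufficient show ?thesis by blast
qed

end
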